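(* Let $\mathcal O\subset\mathbb R^n$ be strictly convex near $\mathrm P_0=(1,0)$, with defining function $F:B(0,r)\to\mathbb R$ as in the context, let $\bar\theta\in\mathbb S^{n-2}$, $\phi_i=-t+\langle\bar\theta,\bar x\rangle$, and let $Z_r$ be the reflected flow map for the wave operator $\Box=\partial_{x_1}^2+\dots+\partial_{x_n}^2-\partial_t^2$ on $(\mathbb R^n\setminus\mathcal O)\times\mathbb R_t$ associated with $\phi_i$, i.e. $$Z_r(s,\bar x,t')=\big(F(\bar x)+2s\,\xi_1^r(\bar x),\ \bar x+2s\,\bar\xi^r(\bar x),\ t'+2s\big),$$ $$\xi_1^r(\bar x)=\frac{2\langle\bar\theta,\nabla F(\bar x)\rangle}{1+|\nabla F(\bar x)|^2},\qquad\bar\xi^r(\bar x)=\bar\theta-\frac{2\langle\bar\theta,\nabla F(\bar x)\rangle}{1+|\nabla F(\bar x)|^2}\nabla F(\bar x).$$ Let $$\omega=\{(s,\bar x,t'):0\le s<s_0,\ \langle\bar\theta,\nabla F(\bar x)\rangle\ge0,\ |\bar x|<r,\ t'\in\mathbb R\},$$ $$\mathring\omega=\{(s,\bar x,t'):0\le s<s_0,\ \langle\bar\theta,\nabla F(\bar x)\rangle>0,\ |\bar x|<r,\ t'\in\mathbb R\}.$$ Then the map $Z_r:\mathring\omega\to Z_r(\mathring\omega)$ is a $C^\infty$ diffeomorphism, which extends to a homeomorphism $Z_r:\omega\to Z_r(\omega)$.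
   Context: Points of $\mathbb R^n$ are $x=(x_1,\bar x)$, $\bar x=(x_2,\dots,x_n)\in\mathbb R^{n-1}$. $\mathcal O\subset\mathbb R^n$ is an open convex set with $C^\infty$ boundary, $\mathrm P_0=(1,0)\in\partial\mathcal O$, the tangent plane to $\partial\mathcal O$ at $\mathrm P_0$ is $x_1=1$, and $\mathcal O$ lies to the left of $\mathrm P_0$ near $\mathrm P_0$. "$\mathcal O$ is strictly convex near $\mathrm P_0$" means: there are an open $\Omega\ni\mathrm P_0$ and an open ball $B(0,r)\subset\mathbb R^{n-1}$ and $F:B(0,r)\to\mathbb R$ with $\partial\mathcal O\cap\Omega=\{(F(\bar x),\bar x):\bar x\in B(0,r)\}$ such that $F\in C^\infty(B(0,r))$, $F(0)=1$, and for all $\bar x,\bar x^*\in B(0,r)$, $F(\bar x^* )-F(\bar x)\le\langle\nabla F(\bar x),\bar x^*-\bar x\rangle$ with equality iff $\bar x=\bar x^*$. Here $s_0>0$. *)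

theory Defs
  imports "HOL-Analysis.Analysis"
begin

text \<open>The space \<open>\<real>\<^sup>n\<close> is \<open>real \<times> 'a\<close> with \<open>'a\<close> a Euclidean space of dimension \<open>n - 1 \<ge> 1\<close>,
  and \<open>(x\<^sub>1, \<dots>, x\<^sub>n, t)\<close> lives in \<open>real \<times> 'a \<times> real\<close>. The product norms are Euclidean.\<close>

text \<open>Meaningful for open \<open>U\<close>: the derivatives are taken in the ambient space.\<close>

primrec Ck_on :: "nat \<Rightarrow> ('a::euclidean_space \<Rightarrow> 'b::euclidean_space) \<Rightarrow> 'a set \<Rightarrow> bool" where
  "Ck_on 0 f U \<longleftrightarrow> continuous_on U f"
| "Ck_on (Suc k) f U \<longleftrightarrow>
     (\<forall>x\<in>U. f differentiable (at x)) \<and>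
     (\<forall>v. Ck_on k (\<lambda>x. frechet_derivative f (at x) v) U)"

text \<open>On a set that need not be open (such as one containing the face \<open>s = 0\<close>), smooth means
  locally the restriction of a smooth function on an open set. For open \<open>S\<close> this is the usual
  notion, that is, \<open>\<forall>k. Ck_on k f S\<close>.\<close>

definition smooth_on :: "'a::euclidean_space set \<Rightarrow> ('a \<Rightarrow> 'b::euclidean_space) \<Rightarrow> bool" where
  "smooth_on S f \<longleftrightarrow>
     (\<forall>x\<in>S. \<exists>U g. open U \<and> x \<in> U \<and> (\<forall>k. Ck_on k g U) \<and> (\<forall>y\<in>S \<inter> U. g y = f y))"

definition smooth_diffeomorphism ::
  "'a::euclidean_space set \<Rightarrow> 'b::euclidean_space set \<Rightarrow> ('a \<Rightarrow> 'b) \<Rightarrow> ('b \<Rightarrow> 'a) \<Rightarrow> bool" where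
  "smooth_diffeomorphism S T f g \<longleftrightarrow>
     smooth_on S f \<and> f ` S = T \<and> (\<forall>x\<in>S. g (f x) = x) \<and>
     smooth_on T g \<and> g ` T = S \<and> (\<forall>y\<in>T. f (g y) = y)"

text \<open>Unspecified where \<open>f\<close> is not differentiable.\<close>

definition gradient :: "('a::real_inner \<Rightarrow> real) \<Rightarrow> 'a \<Rightarrow> 'a" where
  "gradient f x = (THE D. GDERIV f x :> D)"

definition smooth_boundary :: "'a::euclidean_space set \<Rightarrow> bool" where
  "smooth_boundary S \<longleftrightarrow>
     (\<forall>p\<in>frontier S. \<exists>U \<rho>. open U \<and> p \<in> U \<and> smooth_on U \<rho> \<and>
        (\<forall>x\<in>U. gradient \<rho> x \<noteq> 0) \<and> S \<inter> U = {x \<in> U. \<rho> x < 0})"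

text \<open>The affine tangent plane at \<open>p\<close>, spanned by the velocities of smooth curves in \<open>M\<close>.\<close>

definition tangent_plane :: "'a::euclidean_space set \<Rightarrow> 'a \<Rightarrow> 'a set" where
  "tangent_plane M p =
     {p + v | v. \<exists>\<epsilon>>0. \<exists>\<gamma> :: real \<Rightarrow> 'a. smooth_on {-\<epsilon><..<\<epsilon>} \<gamma> \<and>
        \<gamma> ` {-\<epsilon><..<\<epsilon>} \<subseteq> M \<and> \<gamma> 0 = p \<and> (\<gamma> has_vector_derivative v) (at 0)}"

definition P0 :: "real \<times> 'a::euclidean_space" where
  "P0 = (1, 0)"

definition strictly_convex_near_P0 ::
  "(real \<times> 'a::euclidean_space) set \<Rightarrow> real \<Rightarrow> ('a \<Rightarrow> real) \<Rightarrow> bool" where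
  "strictly_convex_near_P0 \<O> r F \<longleftrightarrow>
     0 < r \<and>
     (\<exists>\<Omega>. open \<Omega> \<and> P0 \<in> \<Omega> \<and> frontier \<O> \<inter> \<Omega> = {(F x, x) | x. x \<in> ball 0 r}) \<and>
     smooth_on (ball 0 r) F \<and>
     F 0 = 1 \<and>
     (\<forall>x\<in>ball 0 r. \<forall>y\<in>ball 0 r.
        F y - F x \<le> gradient F x \<bullet> (y - x) \<and>
        (F y - F x = gradient F x \<bullet> (y - x) \<longleftrightarrow> x = y))"

text \<open>The incoming phase \<open>-t + \<theta> \<bullet> x\<close> has spatial direction \<open>(0, \<theta>)\<close>; \<open>(\<xi>\<^sub>1, \<xi>)\<close> below is its mirror
  image in the hyperplane orthogonal to the normal \<open>(1, -gradient F x)\<close> of the graph of \<open>F\<close>.\<close>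

definition \<xi>1_r :: "('a::euclidean_space \<Rightarrow> real) \<Rightarrow> 'a \<Rightarrow> 'a \<Rightarrow> real" where
  "\<xi>1_r F \<theta> x = 2 * (\<theta> \<bullet> gradient F x) / (1 + (norm (gradient F x))\<^sup>2)"

definition \<xi>bar_r :: "('a::euclidean_space \<Rightarrow> real) \<Rightarrow> 'a \<Rightarrow> 'a \<Rightarrow> 'a" where
  "\<xi>bar_r F \<theta> x =
     \<theta> - (2 * (\<theta> \<bullet> gradient F x) / (1 + (norm (gradient F x))\<^sup>2)) *\<^sub>R gradient F x"

definition Z_r ::
  "('a::euclidean_space \<Rightarrow> real) \<Rightarrow> 'a \<Rightarrow> real \<times> 'a \<times> real \<Rightarrow> real \<times> 'a \<times> real" where
  "Z_r F \<theta> = (\<lambda>(s, x, t').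
     (F x + 2 * s * \<xi>1_r F \<theta> x, x + (2 * s) *\<^sub>R \<xi>bar_r F \<theta> x, t' + 2 * s))"

definition \<omega>_glancing ::
  "('a::euclidean_space \<Rightarrow> real) \<Rightarrow> real \<Rightarrow> 'a \<Rightarrow> real \<Rightarrow> (real \<times> 'a \<times> real) set" where
  "\<omega>_glancing F r \<theta> s0 =
     {(s, x, t'). 0 \<le> s \<and> s < s0 \<and> \<theta> \<bullet> gradient F x \<ge> 0 \<and> norm x < r}"

definition \<omega>_ring ::
  "('a::euclidean_space \<Rightarrow> real) \<Rightarrow> real \<Rightarrow> 'a \<Rightarrow> real \<Rightarrow> (real \<times> 'a \<times> real) set" where
  "\<omega>_ring F r \<theta> s0 =
     {(s, x, t'). 0 \<le> s \<and> s < s0 \<and> \<theta> \<bullet> gradient F x > 0 \<and> norm x < r}"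

end

(* A reflected ray from the graph point X with unit normal \<mu> is X + a (e - 2 (e \<bullet> \<mu>) \<mu>), where e is
   the incoming direction. If two such rays, issued from points each of which lies below the tangent
   plane of the other, meet (at any times) and e \<bullet> \<mu>, e \<bullet> \<nu> \<le> 0, then the two support inequalities
   combine with the Cauchy-Schwarz and arithmetic-geometric mean inequalities to show that the second
   point lies on the tangent plane of the first, so strict convexity makes the points coincide. The
   argument passes to limits of graph points and of unit normals even at the boundary of the
   ball, where the gradient of F may blow up; hence it yields the continuity of the inverse together
   with injectivity. On the illuminated part, a kernel vector (\<sigma>, h, \<tau>) of the derivative satisfies
   2 \<sigma> = - (\<theta> \<bullet> h), because rays are orthogonal to wave fronts, and concavity of F then forces
   |h|^2 - (\<theta> \<bullet> h)^2 + (gradient F \<bullet> h)^2 \<le> 0, hence h = 0. The smooth local inverses agree with the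
   global one by its continuity. *)
theory Submission
  imports Defs
begin

subsection \<open>Calculus of \<open>C\<^sup>k\<close> maps\<close>

lemma Ck_on_cong:
  fixes f g :: "'a::euclidean_space \<Rightarrow> 'b::euclidean_space"
  assumes "open U" "\<And>x. x \<in> U \<Longrightarrow> f x = g x" "Ck_on k f U"
  shows "Ck_on k g U"
  using assms(2,3)
proof (induction k arbitrary: f g)
  case 0
  then show ?case by (auto cong: continuous_on_cong)
next
  case (Suc k)
  have d: "f differentiable at x" if "x \<in> U" for x using Suc.prems(2) that by auto
  have D: "(g has_derivative frechet_derivative f (at x)) (at x)" if "x \<in> U" for x
    using has_derivative_transform_within_open[OF _ \<open>open U\<close> that Suc.prems(1)] d[OF that]
    by (simp add: frechet_derivative_works)
  have "Ck_on k (\<lambda>x. frechet_derivative g (at x) v) U" for v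
  proof (rule Suc.IH)
    show "frechet_derivative f (at x) v = frechet_derivative g (at x) v" if "x \<in> U" for x
      by (rule arg_cong[where f = "\<lambda>h. h v"]) (rule frechet_derivative_at[OF D[OF that]])
  qed (use Suc.prems(2) in simp)
  then show ?case
    using D by (auto simp: differentiable_def)
qed


text \<open>Any explicit formula \<open>f'\<close> may stand in for the choice-based
  \<open>frechet_derivative\<close>, by uniqueness of derivatives. The inductions for sums,
  products, composition and reciprocals run through this form.\<close>

lemma Ck_on_SucI:
  fixes f :: "'a::euclidean_space \<Rightarrow> 'b::euclidean_space"
  assumes "open U" and D: "\<And>x. x \<in> U \<Longrightarrow> (f has_derivative f' x) (at x)"
    and "\<And>v. Ck_on k (\<lambda>x. f' x v) U"
  shows "Ck_on (Suc k) f U"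
proof -
  have "Ck_on k (\<lambda>x. frechet_derivative f (at x) v) U" for v
  proof (rule Ck_on_cong[OF \<open>open U\<close> _ assms(3)[of v]])
    show "f' x v = frechet_derivative f (at x) v" if "x \<in> U" for x
      by (rule arg_cong[where f = "\<lambda>h. h v"]) (rule frechet_derivative_at[OF D[OF that]])
  qed
  then show ?thesis
    using D by (auto simp: differentiable_def)
qed

lemma Ck_on_SucD:
  assumes "Ck_on (Suc k) f U" "x \<in> U"
  shows "(f has_derivative frechet_derivative f (at x)) (at x)"
  using assms by (auto simp: frechet_derivative_works)

lemma Ck_on_subset: "Ck_on k f U \<Longrightarrow> V \<subseteq> U \<Longrightarrow> Ck_on k f V"
  by (induction k arbitrary: f) (auto intro: continuous_on_subset)

text \<open>\<open>Ck_on (Suc k)\<close> has no continuity clause for \<open>f\<close> itself; the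
  classes are nested because differentiability gives continuity at the bottom level.\<close>

lemma Ck_on_Suc_imp: "Ck_on (Suc k) f U \<Longrightarrow> Ck_on k f U"
proof (induction k arbitrary: f)
  case 0
  then have "f differentiable_on U"
    by (simp add: differentiable_at_imp_differentiable_on)
  then show ?case
    by (simp add: differentiable_imp_continuous_on)
qed auto

lemma Ck_on_local:
  assumes "\<And>x. x \<in> U \<Longrightarrow> \<exists>V. open V \<and> x \<in> V \<and> Ck_on k f V"
  shows "Ck_on k f U"
  using assms
proof (induction k arbitrary: f)
  case 0
  then show ?case
    by (metis Ck_on.simps(1) continuous_at_imp_continuous_on continuous_on_eq_continuous_at)
next
  case (Suc k)
  have "f differentiable at x" if "x \<in> U" for x
    using Suc.prems[OF that] by auto
  moreover have "Ck_on k (\<lambda>x. frechet_derivative f (at x) v) U" for v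
  proof (rule Suc.IH)
    fix x assume "x \<in> U"
    then obtain V where "open V" "x \<in> V" "Ck_on (Suc k) f V"
      using Suc.prems by blast
    then show "\<exists>V. open V \<and> x \<in> V \<and> Ck_on k (\<lambda>x. frechet_derivative f (at x) v) V"
      by auto
  qed
  ultimately show ?case by simp
qed

lemma Ck_on_const: "Ck_on k (\<lambda>x. c) U"
  by (induction k arbitrary: c) auto

lemma Ck_on_bounded_linear:
  assumes "bounded_linear L" shows "Ck_on k L U"
proof (cases k)
  case 0
  then show ?thesis using assms by (simp add: linear_continuous_on)
next
  case (Suc m)
  have "frechet_derivative L (at x) = L" for x
    using frechet_derivative_at[OF bounded_linear_imp_has_derivative[OF assms]] by metis
  then show ?thesis using Suc assms
    by (auto simp: Ck_on_const bounded_linear_imp_differentiable)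
qed

lemma Ck_on_linear_comp:
  assumes "open U" "bounded_linear L" "Ck_on k f U"
  shows "Ck_on k (\<lambda>x. L (f x)) U"
  using assms(3)
proof (induction k arbitrary: f)
  case 0
  then show ?case
    by (auto intro: bounded_linear.continuous_on[OF assms(2)])
next
  case (Suc k)
  then show ?case
    by (intro Ck_on_SucI[OF \<open>open U\<close> bounded_linear.has_derivative[OF assms(2) Ck_on_SucD[OF Suc.prems]]])
       auto
qed

lemma Ck_on_add:
  assumes "open U" "Ck_on k f U" "Ck_on k g U"
  shows "Ck_on k (\<lambda>x. f x + g x) U"
  using assms(2,3)
proof (induction k arbitrary: f g)
  case 0
  then show ?case by (auto intro: continuous_on_add)
next
  case (Suc k)
  then show ?case
    by (intro Ck_on_SucI[OF \<open>open U\<close> has_derivative_add[OF Ck_on_SucD[OF Suc.prems(1)] Ck_on_SucD[OF Suc.prems(2)]]])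
       auto
qed

lemma Ck_on_minus: "open U \<Longrightarrow> Ck_on k f U \<Longrightarrow> Ck_on k (\<lambda>x. - f x) U"
  by (rule Ck_on_linear_comp[of U uminus]) (auto intro: bounded_linear_minus bounded_linear_ident)

lemma Ck_on_diff: "open U \<Longrightarrow> Ck_on k f U \<Longrightarrow> Ck_on k g U \<Longrightarrow> Ck_on k (\<lambda>x. f x - g x) U"
  using Ck_on_add[of U k f "\<lambda>x. - g x"] Ck_on_minus[of U k g] by simp

lemma Ck_on_sum:
  assumes "open U" "\<And>i. i \<in> I \<Longrightarrow> Ck_on k (f i) U"
  shows "Ck_on k (\<lambda>x. \<Sum>i\<in>I. f i x) U"
  using assms(2)
  by (induction I rule: infinite_finite_induct) (auto intro: Ck_on_const Ck_on_add[OF assms(1)])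

text \<open>The product rule yields two terms of the same bilinear shape, each pairing an
  undifferentiated factor, lowered to order \<open>k\<close>, with a derivative of the
  other.\<close>

lemma Ck_on_bilinear:
  assumes "bounded_bilinear B" "open U" "Ck_on k f U" "Ck_on k g U"
  shows "Ck_on k (\<lambda>x. B (f x) (g x)) U"
  using assms(3,4)
proof (induction k arbitrary: f g)
  case 0
  then show ?case by (auto intro: bounded_bilinear.continuous_on[OF assms(1)])
next
  case (Suc k)
  show ?case
  proof (rule Ck_on_SucI[OF \<open>open U\<close>
        bounded_bilinear.FDERIV[OF assms(1) Ck_on_SucD[OF Suc.prems(1)] Ck_on_SucD[OF Suc.prems(2)]]])
    show "Ck_on k (\<lambda>x. B (f x) (frechet_derivative g (at x) v) +
            B (frechet_derivative f (at x) v) (g x)) U" for v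
      using Suc.prems
      by (intro Ck_on_add[OF \<open>open U\<close>] Suc.IH Ck_on_Suc_imp[OF Suc.prems(1)] Ck_on_Suc_imp[OF Suc.prems(2)]) auto
  qed
qed

lemmas Ck_on_scaleR = Ck_on_bilinear[OF bounded_bilinear_scaleR]
lemmas Ck_on_mult = Ck_on_bilinear[OF bounded_bilinear_mult]
lemmas Ck_on_inner = Ck_on_bilinear[OF bounded_bilinear_inner]

lemma Ck_on_Pair:
  assumes "open U" "Ck_on k f U" "Ck_on k g U"
  shows "Ck_on k (\<lambda>x. (f x, g x)) U"
proof -
  have "Ck_on k (\<lambda>x. (f x, 0) + (0, g x)) U"
    using assms
    by (intro Ck_on_add Ck_on_linear_comp[of U "\<lambda>y. (y, 0)" k f] Ck_on_linear_comp[of U "\<lambda>y. (0, y)" k g]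
        bounded_linear_Pair bounded_linear_ident bounded_linear_zero)
  then show ?thesis by simp
qed

text \<open>\<open>Ck_on\<close> controls derivatives only in fixed directions. Expanding in the
  basis moves a varying direction into scalar coefficients, as needed for the chain rule and for
  inverse maps.\<close>

lemma bounded_linear_eq_sum_Basis:
  assumes "bounded_linear (L :: 'a::euclidean_space \<Rightarrow> 'b::real_normed_vector)"
  shows "(\<Sum>b\<in>Basis. (v \<bullet> b) *\<^sub>R L b) = L v"
proof -
  interpret bounded_linear L by fact
  have "L v = L (\<Sum>b\<in>Basis. (v \<bullet> b) *\<^sub>R b)"
    by (simp add: euclidean_representation)
  also have "\<dots> = (\<Sum>b\<in>Basis. (v \<bullet> b) *\<^sub>R L b)"
    by (simp add: sum scaleR)
  finally show ?thesis by simp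
qed

lemma Ck_on_compose:
  fixes f :: "'b::euclidean_space \<Rightarrow> 'c::euclidean_space" and g :: "'a::euclidean_space \<Rightarrow> 'b"
  assumes "open U" "Ck_on k f V" "Ck_on k g U" "g ` U \<subseteq> V"
  shows "Ck_on k (\<lambda>x. f (g x)) U"
  using assms(2,3)
proof (induction k arbitrary: f)
  case 0
  then show ?case using assms(4) by (auto intro: continuous_on_compose2)
next
  case (Suc k)
  let ?D = "\<lambda>x. frechet_derivative f (at x)"
  have D: "(f has_derivative ?D (g x)) (at (g x))" if "x \<in> U" for x
    using Ck_on_SucD[OF Suc.prems(1)] assms(4) that by blast
  show ?case
  proof (rule Ck_on_SucI[OF \<open>open U\<close>])
    show "((\<lambda>x. f (g x)) has_derivative
       (\<lambda>v. ?D (g x) (frechet_derivative g (at x) v))) (at x)" if "x \<in> U" for x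
      using has_derivative_compose[OF Ck_on_SucD[OF Suc.prems(2) that] D[OF that]] .
    fix v
    \<comment> \<open>The direction in which \<open>f\<close> is differentiated varies with
      \<open>x\<close>; after expansion only derivatives of \<open>f\<close> along fixed basis
      vectors are composed with \<open>g\<close>, and the induction hypothesis covers these.\<close>
    have "Ck_on k (\<lambda>x. \<Sum>b\<in>Basis. (frechet_derivative g (at x) v \<bullet> b) *\<^sub>R ?D (g x) b) U"
      using Suc.prems Ck_on_Suc_imp[OF Suc.prems(2)]
      by (intro Ck_on_sum Ck_on_scaleR Ck_on_inner Ck_on_const Suc.IH \<open>open U\<close>) auto
    then show "Ck_on k (\<lambda>x. ?D (g x) (frechet_derivative g (at x) v)) U"
      by (rule Ck_on_cong[OF \<open>open U\<close>, rotated])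
        (intro bounded_linear_eq_sum_Basis has_derivative_bounded_linear[OF D])
  qed
qed

lemma Ck_on_inverse:
  fixes f :: "'a::euclidean_space \<Rightarrow> real"
  assumes "open U" "Ck_on k f U" "\<And>x. x \<in> U \<Longrightarrow> f x \<noteq> 0"
  shows "Ck_on k (\<lambda>x. inverse (f x)) U"
  using assms(2)
proof (induction k)
  case 0
  then show ?case using assms(3) by (auto intro!: continuous_on_inverse)
next
  case (Suc k)
  show ?case
  proof (rule Ck_on_SucI[OF \<open>open U\<close> Deriv.has_derivative_inverse[OF assms(3) Ck_on_SucD[OF Suc.prems]]])
    show "Ck_on k (\<lambda>x. - (inverse (f x) * frechet_derivative f (at x) v * inverse (f x))) U" for v
      using Suc Ck_on_Suc_imp[OF Suc.prems]
      by (intro Ck_on_minus Ck_on_mult Suc.IH \<open>open U\<close>) auto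
  qed
qed

lemma Ck_on_divide:
  fixes f g :: "'a::euclidean_space \<Rightarrow> real"
  assumes "open U" "Ck_on k f U" "Ck_on k g U" "\<And>x. x \<in> U \<Longrightarrow> g x \<noteq> 0"
  shows "Ck_on k (\<lambda>x. f x / g x) U"
  unfolding divide_inverse using assms by (intro Ck_on_mult Ck_on_inverse)

lemma smooth_on_imp_Ck_on:
  assumes "open S" "smooth_on S f" shows "Ck_on k f S"
proof (rule Ck_on_local)
  fix x assume "x \<in> S"
  then obtain U g where U: "open U" "x \<in> U" "\<forall>k. Ck_on k g U" "\<forall>y\<in>S \<inter> U. g y = f y"
    using assms(2) unfolding smooth_on_def by blast
  then have "Ck_on k f (S \<inter> U)"
    using assms(1) by (intro Ck_on_cong[of "S \<inter> U" g f]) (auto intro: Ck_on_subset)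
  then show "\<exists>V. open V \<and> x \<in> V \<and> Ck_on k f V"
    using U assms(1) \<open>x \<in> S\<close> by blast
qed

subsection \<open>The smooth inverse function theorem\<close>

text \<open>Invariance of domain makes the image open and the inverse continuous, so pointwise
  differentiability with injective derivatives suffices. Equal finite dimensions turn injectivity of
  \<open>f' (g y)\<close> into invertibility.\<close>

lemma has_derivative_inverse_of_injective:
  fixes f g :: "'a::euclidean_space \<Rightarrow> 'a"
  assumes "open U"
    and D: "\<And>x. x \<in> U \<Longrightarrow> (f has_derivative f' x) (at x)"
    and "\<And>x. x \<in> U \<Longrightarrow> inj (f' x)"
    and gf: "\<And>x. x \<in> U \<Longrightarrow> g (f x) = x"
  shows "open (f ` U)"
    and "y \<in> f ` U \<Longrightarrow> \<exists>g'. (g has_derivative g') (at y) \<and> (\<forall>v. f' (g y) (g' v) = v)"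
proof -
  have cont: "continuous_on U f"
    using D by (meson continuous_at_imp_continuous_on has_derivative_continuous)
  have "inj_on f U"
    using gf by (rule inj_on_inverseI)
  then show op: "open (f ` U)"
    using invariance_of_domain cont \<open>open U\<close> by blast
  assume y: "y \<in> f ` U"
  then have gy: "g y \<in> U" "f (g y) = y" using gf by auto
  have lin: "linear (f' (g y))"
    using D[OF gy(1)] by (rule has_derivative_linear)
  obtain g' where g': "linear g'" "\<forall>x. g' (f' (g y) x) = x" "\<forall>x. f' (g y) (g' x) = x"
    using linear_injective_isomorphism[OF lin assms(3)[OF gy(1)]] by blast
  have "continuous_on (f ` U) g"
    using continuous_on_inverse_open[OF \<open>open U\<close> cont _ gf] by simp
  then have "continuous (at y) g"
    using op y continuous_on_eq_continuous_at by blast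
  have "(g has_derivative g') (at y)"
  proof (rule has_derivative_inverse_basic[where f = f and g = g, OF D[OF gy(1)]])
    show "bounded_linear g'" using g'(1) by (simp add: linear_conv_bounded_linear)
    show "g' \<circ> f' (g y) = id" using g'(2) by auto
    show "continuous (at y) g" "open (f ` U)" "y \<in> f ` U" by fact+
    show "f (g z) = z" if "z \<in> f ` U" for z using that gf by auto
  qed
  then show "\<exists>g'. (g has_derivative g') (at y) \<and> (\<forall>v. f' (g y) (g' v) = v)"
    using g'(3) by blast
qed

text \<open>Bootstrap: once the derivative \<open>H\<close> of \<open>g\<close> is known to be
  differentiable, differentiating the identity Df(g y)(H w y) = w expresses the derivative of
  \<open>H\<close> through \<open>H\<close>, \<open>g\<close> and second derivatives of
  \<open>f\<close>. Each order of smoothness of \<open>H\<close> then yields the next.\<close>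

lemma Ck_on_inverse_of_injective:
  fixes f g :: "'a::euclidean_space \<Rightarrow> 'a"
  assumes "open U" and smooth: "\<And>k. Ck_on k f U"
    and inj: "\<And>x. x \<in> U \<Longrightarrow> inj (frechet_derivative f (at x))"
    and gf: "\<And>x. x \<in> U \<Longrightarrow> g (f x) = x"
  shows "Ck_on k g (f ` U)"
proof -
  define V where "V = f ` U"
  \<comment> \<open>\<open>P\<close> collects the partial derivatives of \<open>f\<close>,
    \<open>Q\<close> the second partials, and \<open>H v\<close> is the derivative of the inverse in
    direction \<open>v\<close>.\<close>
  define P where "P i x = frechet_derivative f (at x) i" for i x
  define Q where "Q i j x = frechet_derivative (P j) (at x) i" for i j x
  define H where "H v y = frechet_derivative g (at y) v" for v y
  have D: "(f has_derivative (\<lambda>v. \<Sum>i\<in>Basis. (v \<bullet> i) *\<^sub>R P i x)) (at x)" if "x \<in> U" for x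
  proof -
    have *: "(f has_derivative frechet_derivative f (at x)) (at x)"
      using Ck_on_SucD[OF smooth that] .
    have "(\<lambda>v. \<Sum>i\<in>Basis. (v \<bullet> i) *\<^sub>R P i x) = frechet_derivative f (at x)"
      unfolding P_def by (rule ext) (rule bounded_linear_eq_sum_Basis[OF has_derivative_bounded_linear[OF *]])
    then show ?thesis using * by simp
  qed
  have fD: "frechet_derivative f (at x) = (\<lambda>v. \<Sum>i\<in>Basis. (v \<bullet> i) *\<^sub>R P i x)" if "x \<in> U" for x
    using frechet_derivative_at[OF D[OF that]] by simp
  have smooth_P: "Ck_on k (P i) U" for i k
    using smooth[of "Suc k"] unfolding P_def by simp
  have smooth_Q: "Ck_on k (Q i j) U" for i j k
    using smooth_P[of "Suc k"] unfolding Q_def by simp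
  have DP: "(P j has_derivative (\<lambda>v. \<Sum>i\<in>Basis. (v \<bullet> i) *\<^sub>R Q i j x)) (at x)" if "x \<in> U" for x j
  proof -
    have *: "(P j has_derivative frechet_derivative (P j) (at x)) (at x)"
      using Ck_on_SucD[OF smooth_P that] .
    have "(\<lambda>v. \<Sum>i\<in>Basis. (v \<bullet> i) *\<^sub>R Q i j x) = frechet_derivative (P j) (at x)"
      unfolding Q_def by (rule ext) (rule bounded_linear_eq_sum_Basis[OF has_derivative_bounded_linear[OF *]])
    then show ?thesis using * by simp
  qed
  have "open V"
    unfolding V_def
    using has_derivative_inverse_of_injective(1)[OF \<open>open U\<close> D _ gf] inj fD by simp
  have gV: "g y \<in> U" "f (g y) = y" if "y \<in> V" for y
    using that gf unfolding V_def by auto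
  have Dg: "(g has_derivative (\<lambda>v. H v y)) (at y)"
    and fH: "(\<Sum>i\<in>Basis. (H v y \<bullet> i) *\<^sub>R P i (g y)) = v" if "y \<in> V" for y v
  proof -
    have inj': "inj (\<lambda>v. \<Sum>i\<in>Basis. (v \<bullet> i) *\<^sub>R P i x)" if "x \<in> U" for x
      using inj[OF that] fD[OF that] by simp
    have "\<exists>g'. (g has_derivative g') (at y) \<and> (\<forall>v. (\<Sum>i\<in>Basis. (g' v \<bullet> i) *\<^sub>R P i (g y)) = v)"
      by (rule has_derivative_inverse_of_injective(2)[OF \<open>open U\<close> D inj' gf])
        (use that in \<open>auto simp: V_def\<close>)
    then obtain g' where g': "(g has_derivative g') (at y)"
        "\<forall>v. (\<Sum>i\<in>Basis. (g' v \<bullet> i) *\<^sub>R P i (g y)) = v"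
      by blast
    have "g' = (\<lambda>v. H v y)"
      using frechet_derivative_at[OF g'(1)] unfolding H_def by simp
    then show "(g has_derivative (\<lambda>v. H v y)) (at y)" "(\<Sum>i\<in>Basis. (H v y \<bullet> i) *\<^sub>R P i (g y)) = v"
      using g' by auto
  qed
  have H_lin: "(\<Sum>i\<in>Basis. (v \<bullet> i) *\<^sub>R H i y) = H v y" if "y \<in> V" for v y
    by (rule bounded_linear_eq_sum_Basis[OF has_derivative_bounded_linear[OF Dg[OF that]]])
  have Hf: "H (\<Sum>i\<in>Basis. (v \<bullet> i) *\<^sub>R P i (g y)) y = v" if "y \<in> V" for v y
  proof -
    have "inj (\<lambda>v. \<Sum>i\<in>Basis. (v \<bullet> i) *\<^sub>R P i (g y))"
      using inj[OF gV(1)[OF that]] fD[OF gV(1)[OF that]] by simp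
    then show ?thesis
      using fH[OF that, of "\<Sum>i\<in>Basis. (v \<bullet> i) *\<^sub>R P i (g y)"] by (rule injD)
  qed
  txt \<open>The tangent map of \<open>f\<close> is again injective with injective derivative, so its inverse
    \<open>(y, w) \<mapsto> (g y, H w y)\<close> is differentiable.\<close>
  have H_diff: "H w differentiable at y" if "y \<in> V" for w y
  proof -
    define T where "T = (\<lambda>z::'a \<times> 'a. (f (fst z), \<Sum>j\<in>Basis. (snd z \<bullet> j) *\<^sub>R P j (fst z)))"
    define T' where "T' z = (\<lambda>h::'a \<times> 'a. (\<Sum>i\<in>Basis. (fst h \<bullet> i) *\<^sub>R P i (fst z),
        \<Sum>j\<in>Basis. (snd z \<bullet> j) *\<^sub>R (\<Sum>i\<in>Basis. (fst h \<bullet> i) *\<^sub>R Q i j (fst z))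
           + (snd h \<bullet> j) *\<^sub>R P j (fst z)))" for z
    define G where "G = (\<lambda>z::'a \<times> 'a. (g (fst z), H (snd z) (fst z)))"
    have DT: "(T has_derivative T' z) (at z)" if "z \<in> U \<times> UNIV" for z
    proof -
      have fz: "fst z \<in> U" using that by auto
      have 1: "((\<lambda>z::'a \<times> 'a. f (fst z)) has_derivative
          (\<lambda>h. \<Sum>i\<in>Basis. (fst h \<bullet> i) *\<^sub>R P i (fst z))) (at z)"
        using has_derivative_compose[OF has_derivative_fst[OF has_derivative_ident] D[OF fz]] .
      have 2: "((\<lambda>z::'a \<times> 'a. P j (fst z)) has_derivative
          (\<lambda>h. \<Sum>i\<in>Basis. (fst h \<bullet> i) *\<^sub>R Q i j (fst z))) (at z)" for j
        using has_derivative_compose[OF has_derivative_fst[OF has_derivative_ident] DP[OF fz]] .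
      show ?thesis
        unfolding T_def T'_def
        by (intro has_derivative_Pair 1 has_derivative_sum has_derivative_scaleR 2
            has_derivative_inner_left has_derivative_snd has_derivative_ident)
    qed
    have T'_inj: "inj (T' z)" if "z \<in> U \<times> UNIV" for z
    proof -
      have inj0: "v = 0" if "(\<Sum>i\<in>Basis. (v \<bullet> i) *\<^sub>R P i (fst z)) = 0" for v
      proof -
        have "frechet_derivative f (at (fst z)) v = frechet_derivative f (at (fst z)) 0"
          using that fD[of "fst z"] \<open>z \<in> U \<times> UNIV\<close> by auto
        then show "v = 0" using inj[of "fst z"] \<open>z \<in> U \<times> UNIV\<close> by (auto dest: injD)
      qed
      have "h = 0" if "T' z h = 0" for h
      proof -
        have e: "fst (T' z h) = 0" "snd (T' z h) = 0"
          using that by simp_all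
        have "fst h = 0"
          by (rule inj0) (rule e(1)[unfolded T'_def fst_conv])
        moreover have "snd h = 0"
          by (rule inj0) (use e(2) \<open>fst h = 0\<close> in \<open>simp add: T'_def\<close>)
        ultimately show ?thesis by (simp add: prod_eq_iff)
      qed
      then show ?thesis
        using linear_injective_0[OF has_derivative_linear[OF DT[OF that]]] by blast
    qed
    have GT: "G (T z) = z" if "z \<in> U \<times> UNIV" for z
    proof -
      have "f (fst z) \<in> V" "g (f (fst z)) = fst z" using that gf unfolding V_def by auto
      then show ?thesis
        using Hf[of "f (fst z)" "snd z"] unfolding G_def T_def by (simp add: prod_eq_iff)
    qed
    have "(y, w) = T (g y, H w y)"
      using gV[OF that] fH[OF that] unfolding T_def by simp
    then have yw: "(y, w) \<in> T ` (U \<times> UNIV)" using gV[OF that] by auto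
    have "\<exists>G'. (G has_derivative G') (at (y, w)) \<and> (\<forall>v. T' (G (y, w)) (G' v) = v)"
      by (rule has_derivative_inverse_of_injective(2)[OF open_Times[OF \<open>open U\<close> open_UNIV] DT T'_inj GT yw])
    then obtain G' where G': "(G has_derivative G') (at (y, w))"
      by blast
    have "((\<lambda>y. (y, w)) has_derivative (\<lambda>h. (h, 0))) (at y)"
      by (intro has_derivative_Pair has_derivative_ident has_derivative_const)
    from has_derivative_snd[OF has_derivative_compose[OF this G']]
    have "((\<lambda>y. snd (G (y, w))) has_derivative (\<lambda>h. snd (G' (h, 0)))) (at y)"
      .
    then show ?thesis
      unfolding G_def differentiable_def by auto
  qed
  \<comment> \<open>\<open>S w z y\<close> is the second derivative of \<open>f\<close> at
    \<open>g y\<close>, applied to the directions \<open>H w y\<close> and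
    \<open>H z y\<close>.\<close>
  define S where "S w z y = (\<Sum>j\<in>Basis. (H w y \<bullet> j) *\<^sub>R (\<Sum>i\<in>Basis. (H z y \<bullet> i) *\<^sub>R Q i j (g y)))" for w z y
  have DH: "(H w has_derivative (\<lambda>z. - (\<Sum>b\<in>Basis. (S w z y \<bullet> b) *\<^sub>R H b y))) (at y)"
    if "y \<in> V" for w y
  proof -
    from H_diff[OF that] obtain H' where H': "(H w has_derivative H') (at y)"
      unfolding differentiable_def by blast
    have DPg: "((\<lambda>y. P j (g y)) has_derivative (\<lambda>z. \<Sum>i\<in>Basis. (H z y \<bullet> i) *\<^sub>R Q i j (g y))) (at y)" for j
      using has_derivative_compose[OF Dg[OF that] DP[OF gV(1)[OF that]]] .
    \<comment> \<open>One map, two derivatives: the product rule gives this one, and constancy of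
      the map on \<open>V\<close> (by \<open>fH\<close>) gives zero. Applying \<open>Hf\<close> to
      their equality determines \<open>H'\<close>.\<close>
    have "((\<lambda>y. \<Sum>j\<in>Basis. (H w y \<bullet> j) *\<^sub>R P j (g y)) has_derivative
        (\<lambda>z. \<Sum>j\<in>Basis. (H w y \<bullet> j) *\<^sub>R (\<Sum>i\<in>Basis. (H z y \<bullet> i) *\<^sub>R Q i j (g y))
           + (H' z \<bullet> j) *\<^sub>R P j (g y))) (at y)"
      by (intro has_derivative_sum has_derivative_scaleR DPg has_derivative_inner_left H')
    moreover have "((\<lambda>y. \<Sum>j\<in>Basis. (H w y \<bullet> j) *\<^sub>R P j (g y)) has_derivative (\<lambda>z. 0)) (at y)"
      by (rule has_derivative_transform_within_open[OF has_derivative_const[of w] \<open>open V\<close> that])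
        (use fH in auto)
    ultimately have "(\<lambda>z. \<Sum>j\<in>Basis. (H w y \<bullet> j) *\<^sub>R (\<Sum>i\<in>Basis. (H z y \<bullet> i) *\<^sub>R Q i j (g y))
           + (H' z \<bullet> j) *\<^sub>R P j (g y)) = (\<lambda>z. 0)"
      by (rule has_derivative_unique)
    then have "S w z y + (\<Sum>j\<in>Basis. (H' z \<bullet> j) *\<^sub>R P j (g y)) = 0" for z
      unfolding S_def by (simp add: sum.distrib fun_eq_iff)
    then have "(\<Sum>j\<in>Basis. (H' z \<bullet> j) *\<^sub>R P j (g y)) = - S w z y" for z
      by (simp add: add_eq_0_iff)
    then have "H' z = H (- S w z y) y" for z
      using Hf[OF that, of "H' z"] by simp
    then have "H' z = - (\<Sum>b\<in>Basis. (S w z y \<bullet> b) *\<^sub>R H b y)" for z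
      using H_lin[OF that, of "- S w z y"] by (simp add: sum_negf)
    then have "H' = (\<lambda>z. - (\<Sum>b\<in>Basis. (S w z y \<bullet> b) *\<^sub>R H b y))" by blast
    then show ?thesis using H' by simp
  qed
  have gim: "g ` V \<subseteq> U" using gV by auto
  have g_Suc: "Ck_on (Suc k) g V" if "\<And>w. Ck_on k (H w) V" for k
    using Ck_on_SucI[OF \<open>open V\<close> Dg that] .
  have H_Ck: "Ck_on k (H w) V" for k w
  proof (induction k arbitrary: w)
    case 0
    then show ?case
      using H_diff by (simp add: differentiable_imp_continuous_on differentiable_at_imp_differentiable_on)
  next
    case (Suc k)
    have "Ck_on k g V" using g_Suc[OF Suc.IH] by (rule Ck_on_Suc_imp)
    then have "Ck_on k (\<lambda>y. - (\<Sum>b\<in>Basis. (S w z y \<bullet> b) *\<^sub>R H b y)) V" for z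
      unfolding S_def
      by (intro Ck_on_minus Ck_on_sum Ck_on_scaleR Ck_on_inner Ck_on_const Suc.IH \<open>open V\<close>
          Ck_on_compose[OF \<open>open V\<close> smooth_Q _ gim])
    with DH show ?case by (rule Ck_on_SucI[OF \<open>open V\<close>])
  qed
  show ?thesis using g_Suc[OF H_Ck, THEN Ck_on_Suc_imp] unfolding V_def .
qed

text \<open>The C^1 inverse function theorem supplies a neighbourhood on which \<open>f\<close> is a
  homeomorphism with invertible derivatives; \<open>Ck_on_inverse_of_injective\<close> then raises
  the regularity of the inverse.\<close>

lemma smooth_local_inverse:
  fixes f :: "'a::euclidean_space \<Rightarrow> 'a"
  assumes "open S" and smooth: "\<And>k. Ck_on k f S" and "x0 \<in> S"
    and inj: "inj (frechet_derivative f (at x0))"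
  obtains U g where "open U" "U \<subseteq> S" "x0 \<in> U" "open (f ` U)"
    "\<And>x. x \<in> U \<Longrightarrow> g (f x) = x" "\<And>k. Ck_on k g (f ` U)"
proof -
  define f' where "f' x = Blinfun (frechet_derivative f (at x))" for x
  have Df: "(f has_derivative frechet_derivative f (at x)) (at x)" if "x \<in> S" for x
    using Ck_on_SucD[OF smooth that] .
  have f'_apply: "blinfun_apply (f' x) = frechet_derivative f (at x)" if "x \<in> S" for x
    unfolding f'_def using has_derivative_bounded_linear[OF Df[OF that]] by (rule bounded_linear_Blinfun_apply)
  obtain h where h: "linear h" "\<forall>x. h (frechet_derivative f (at x0) x) = x"
    using linear_injective_isomorphism[OF has_derivative_linear[OF Df[OF \<open>x0 \<in> S\<close>]] inj] by blast
  obtain U V g g' where U: "open U" "U \<subseteq> S" "x0 \<in> U" "open V" "homeomorphism U V f g"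
    "\<And>y. y \<in> V \<Longrightarrow> bij (blinfun_apply (f' (g y)))"
  proof (rule inverse_function_theorem[of S f f' x0 "Blinfun h"])
    show "open S" "x0 \<in> S" by fact+
    show "(f has_derivative blinfun_apply (f' x)) (at x)" if "x \<in> S" for x
      using Df[OF that] f'_apply[OF that] by simp
    have "continuous_on S (\<lambda>x. blinfun_apply (f' x) i)" for i
      using smooth[of "Suc 0"] by (simp add: f'_apply cong: continuous_on_cong)
    then show "continuous_on S f'"
      by (rule continuous_on_blinfun_componentwise)
    show "Blinfun h o\<^sub>L f' x0 = id_blinfun"
      using h by (intro blinfun_eqI)
        (simp add: f'_apply[OF \<open>x0 \<in> S\<close>] bounded_linear_Blinfun_apply linear_conv_bounded_linear)
  qed blast
  have fU: "f ` U = V" "\<And>x. x \<in> U \<Longrightarrow> g (f x) = x"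
    using U(5) unfolding homeomorphism_def by auto
  have "inj (frechet_derivative f (at x))" if "x \<in> U" for x
    using U(6)[of "f x"] fU that U(2) f'_apply[of x] by (auto simp: bij_def)
  then have "Ck_on k g (f ` U)" for k
    using fU(2) \<open>open U\<close> Ck_on_subset[OF smooth U(2)] by (intro Ck_on_inverse_of_injective)
  then show ?thesis
    using that[of U g] U fU by blast
qed

subsection \<open>The reflected flow map of a concave graph\<close>

text \<open>Pairing \<open>Y - X\<close> with \<mu> gives (a + b) \<alpha> - 2 b \<beta> k. The
  support inequality at \<open>Y\<close> bounds (a + b) \<beta> by 2 a \<alpha> k, and k^2 \<le> 1
  with 4 a b \<le> (a + b)^2 makes the pairing nonnegative; the support inequality at
  \<open>X\<close> gives the opposite sign.\<close>

lemma reflected_rays_meet: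
  fixes X Y e \<mu> \<nu> :: "'v::real_inner"
  assumes "norm \<mu> = 1" "norm \<nu> = 1" "e \<bullet> \<mu> \<le> 0" "e \<bullet> \<nu> \<le> 0" "0 \<le> a" "0 \<le> b"
    and eq: "X + a *\<^sub>R (e - (2 * (e \<bullet> \<mu>)) *\<^sub>R \<mu>) = Y + b *\<^sub>R (e - (2 * (e \<bullet> \<nu>)) *\<^sub>R \<nu>)"
    and "(Y - X) \<bullet> \<mu> \<le> 0" "(X - Y) \<bullet> \<nu> \<le> 0"
  shows "(Y - X) \<bullet> \<mu> = 0"
proof -
  define \<alpha> \<beta> k where "\<alpha> = - (e \<bullet> \<mu>)" and "\<beta> = - (e \<bullet> \<nu>)" and "k = \<mu> \<bullet> \<nu>"
  have [simp]: "\<mu> \<bullet> \<mu> = 1" "\<nu> \<bullet> \<nu> = 1" using assms by (simp_all add: dot_square_norm)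
  have YX: "Y - X = (a - b) *\<^sub>R e + (2 * a * \<alpha>) *\<^sub>R \<mu> - (2 * b * \<beta>) *\<^sub>R \<nu>"
    using eq unfolding \<alpha>_def \<beta>_def by (simp add: algebra_simps)
  have "\<nu> \<bullet> \<mu> = k" by (simp add: k_def inner_commute)
  then have m: "(Y - X) \<bullet> \<mu> = (a + b) * \<alpha> - 2 * b * \<beta> * k"
    unfolding YX by (simp add: inner_simps \<alpha>_def \<beta>_def algebra_simps)
  have "(X - Y) \<bullet> \<nu> = - ((Y - X) \<bullet> \<nu>)" by (simp add: inner_simps)
  also have "\<dots> = (a + b) * \<beta> - 2 * a * \<alpha> * k"
    unfolding YX by (simp add: inner_simps \<alpha>_def \<beta>_def k_def algebra_simps)
  finally have n: "(a + b) * \<beta> \<le> 2 * a * \<alpha> * k"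
    using assms by simp
  have pos: "0 \<le> \<alpha>" "0 \<le> \<beta>" using assms by (auto simp: \<alpha>_def \<beta>_def)
  have "\<bar>k\<bar> \<le> 1" using Cauchy_Schwarz_ineq2[of \<mu> \<nu>] assms by (simp add: k_def)
  have "2 * b * \<beta> * k \<le> (a + b) * \<alpha>"
  \<comment> \<open>The main chain multiplies the bound by \<open>2 * b * k\<close> and finally
    cancels \<open>a + b\<close>, so both \<open>k\<close> and \<open>a + b\<close> must be positive
    there. Otherwise signs suffice, \<open>a + b = 0\<close> forcing \<open>b = 0\<close>.\<close>
  proof (cases "k \<le> 0 \<or> a + b = 0")
    case True
    then have "b = 0 \<or> k \<le> 0" using assms by auto
    then have "b * \<beta> * k \<le> 0"
      using pos \<open>0 \<le> b\<close> by (auto simp: mult_nonneg_nonpos)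
    moreover have "0 \<le> (a + b) * \<alpha>" using pos assms by simp
    ultimately show ?thesis by linarith
  next
    case False
    then have "0 < k" "0 < a + b" using assms by auto
    have "(a + b) * (2 * b * \<beta> * k) = (2 * b * k) * ((a + b) * \<beta>)" by simp
    also have "\<dots> \<le> (2 * b * k) * (2 * a * \<alpha> * k)"
      using n \<open>0 < k\<close> \<open>0 \<le> b\<close> by (intro mult_left_mono) auto
    also have "\<dots> = (4 * a * b * \<alpha>) * k\<^sup>2" by (simp add: power2_eq_square)
    also have "\<dots> \<le> (4 * a * b * \<alpha>) * 1"
      using \<open>\<bar>k\<bar> \<le> 1\<close> pos assms by (intro mult_left_mono) (auto simp: abs_square_le_1)
    also have "\<dots> \<le> (a + b)\<^sup>2 * \<alpha>"
    proof -
      have "4 * a * b \<le> (a + b)\<^sup>2"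
        using zero_le_power2[of "a - b"] by (simp add: power2_eq_square algebra_simps)
      then show ?thesis using pos by (simp add: mult_right_mono)
    qed
    also have "\<dots> = (a + b) * ((a + b) * \<alpha>)" by (simp add: power2_eq_square)
    finally show ?thesis using \<open>0 < a + b\<close> by simp
  qed
  then show ?thesis using m assms by simp
qed

section \<open>Gradients and convergence along subsequences\<close>

lemma gradient_eq: "GDERIV f x :> D \<Longrightarrow> gradient f x = D"
  unfolding gradient_def
proof (rule the_equality)
  fix E assume "GDERIV f x :> D" "GDERIV f x :> E"
  then have "(\<lambda>h. h \<bullet> E) = (\<lambda>h. h \<bullet> D)"
    unfolding gderiv_def by (rule has_derivative_unique[rotated])
  then show "E = D" by (metis vector_eq_rdot inner_commute)
qed

lemma gradient_euclidean:
  fixes f :: "'a::euclidean_space \<Rightarrow> real"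
  assumes "f differentiable at x"
  shows "GDERIV f x :> gradient f x"
    and "gradient f x = (\<Sum>b\<in>Basis. frechet_derivative f (at x) b *\<^sub>R b)"
proof -
  let ?D = "\<Sum>b\<in>Basis. frechet_derivative f (at x) b *\<^sub>R b"
  have D: "(f has_derivative frechet_derivative f (at x)) (at x)"
    using assms by (simp add: frechet_derivative_works)
  have "frechet_derivative f (at x) = (\<lambda>h. h \<bullet> ?D)"
    using bounded_linear_eq_sum_Basis[OF has_derivative_bounded_linear[OF D]]
    by (auto simp: inner_sum_right fun_eq_iff mult.commute)
  then have G: "GDERIV f x :> ?D"
    using D unfolding gderiv_def by simp
  show "gradient f x = ?D" using gradient_eq[OF G] .
  then show "GDERIV f x :> gradient f x" using G by simp
qed

text \<open>Otherwise a subsequence stays at a fixed positive distance from \<open>l\<close>, and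
  none of its subsequences tends to \<open>l\<close>. In this form compactness can produce the inner
  subsequence and its limit is identified afterwards.\<close>

lemma LIMSEQ_subseqI:
  fixes \<sigma> :: "nat \<Rightarrow> 'a::metric_space"
  assumes "\<And>\<rho> :: nat \<Rightarrow> nat. strict_mono \<rho> \<Longrightarrow> \<exists>\<tau> :: nat \<Rightarrow> nat. strict_mono \<tau> \<and> (\<lambda>n. \<sigma> (\<rho> (\<tau> n))) \<longlonglongrightarrow> l"
  shows "\<sigma> \<longlonglongrightarrow> l"
proof (rule ccontr)
  assume "\<not> \<sigma> \<longlonglongrightarrow> l"
  then obtain e where "e > 0" and e: "\<And>N. \<exists>n\<ge>N. dist (\<sigma> n) l \<ge> e"
    unfolding lim_sequentially not_less[symmetric] by blast
  then have "infinite {n. dist (\<sigma> n) l \<ge> e}"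
    by (auto simp: infinite_nat_iff_unbounded_le)
  from infinite_enumerate[OF this] obtain \<rho> :: "nat \<Rightarrow> nat"
    where \<rho>: "strict_mono \<rho>" "\<forall>n. dist (\<sigma> (\<rho> n)) l \<ge> e"
    by auto
  from assms[OF \<rho>(1)] obtain \<tau> where "(\<lambda>n. \<sigma> (\<rho> (\<tau> n))) \<longlonglongrightarrow> l" by blast
  then obtain N where "\<And>n. n \<ge> N \<Longrightarrow> dist (\<sigma> (\<rho> (\<tau> n))) l < e"
    using \<open>e > 0\<close> by (auto simp: lim_sequentially)
  then show False using \<rho>(2) by (meson not_le order_refl)
qed

section \<open>Normals, reflected directions and smoothness of the flow map\<close>

locale concave_reflector =
  fixes F :: "'a::euclidean_space \<Rightarrow> real" and r :: real and \<theta> :: 'a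
  assumes smooth: "\<And>k. Ck_on k F (ball 0 r)"
    and concave: "\<And>x y. x \<in> ball 0 r \<Longrightarrow> y \<in> ball 0 r \<Longrightarrow> F y - F x \<le> gradient F x \<bullet> (y - x)"
    and strict: "\<And>x y. x \<in> ball 0 r \<Longrightarrow> y \<in> ball 0 r \<Longrightarrow>
      F y - F x = gradient F x \<bullet> (y - x) \<Longrightarrow> x = y"
    and norm_\<theta>: "norm \<theta> = 1"
begin

definition graph :: "'a \<Rightarrow> real \<times> 'a" where "graph x = (F x, x)"

text \<open>The unit normal with positive first component, so that
  \<open>\<theta> \<bullet> gradient F x \<ge> 0\<close> means a nonpositive pairing with the
  incoming direction. It stays in a compact sphere even if the gradient is unbounded near the edge
  of the ball.\<close>

definition normal :: "'a \<Rightarrow> real \<times> 'a" where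
  "normal x = (1 / sqrt (1 + (norm (gradient F x))\<^sup>2)) *\<^sub>R (1, - gradient F x)"

text \<open>A function of the normal rather than of the base point, so that it can be evaluated at
  limits of unit normals not attached to any point of the graph.\<close>

definition reflect :: "real \<times> 'a \<Rightarrow> real \<times> 'a" where
  "reflect \<nu> = (0, \<theta>) - (2 * ((0, \<theta>) \<bullet> \<nu>)) *\<^sub>R \<nu>"

lemma norm_gradient_pos: "0 < 1 + (norm (gradient F x))\<^sup>2"
  by (simp add: add_pos_nonneg)

lemma norm_normal: "norm (normal x) = 1"
  using norm_gradient_pos[of x]
  by (simp add: normal_def norm_Pair power_divide add_divide_distrib[symmetric])

lemma inner_normal:
  "v \<bullet> normal x = (fst v - snd v \<bullet> gradient F x) / sqrt (1 + (norm (gradient F x))\<^sup>2)"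
  by (simp add: normal_def inner_prod_def inner_diff_right diff_divide_distrib)

lemma reflect_normal: "reflect (normal x) = (\<xi>1_r F \<theta> x, \<xi>bar_r F \<theta> x)"
proof -
  let ?q = "1 + (norm (gradient F x))\<^sup>2"
  have "sqrt ?q * sqrt ?q = ?q" using norm_gradient_pos[of x] by simp
  then show ?thesis
    unfolding reflect_def inner_normal
    by (simp add: normal_def \<xi>1_r_def \<xi>bar_r_def prod_eq_iff)
qed

lemma norm_reflect: "norm \<nu> = 1 \<Longrightarrow> norm (reflect \<nu>) = 1"
proof -
  assume "norm \<nu> = 1"
  then have "\<nu> \<bullet> \<nu> = 1" by (simp add: dot_square_norm)
  then have "reflect \<nu> \<bullet> reflect \<nu> = (0::real, \<theta>) \<bullet> (0, \<theta>)"
    unfolding reflect_def by (simp add: inner_diff inner_commute algebra_simps)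
  also have "\<dots> = 1" using norm_\<theta> by (simp add: dot_square_norm)
  finally show ?thesis by (simp add: norm_eq_sqrt_inner)
qed

lemma Z_r_eq: "Z_r F \<theta> (s, x, t) =
   (fst (graph x + (2 * s) *\<^sub>R reflect (normal x)), snd (graph x + (2 * s) *\<^sub>R reflect (normal x)), t + 2 * s)"
  by (simp add: Z_r_def reflect_normal graph_def)

lemma smooth_gradient: "Ck_on k (gradient F) (ball 0 r)"
proof -
  have "Ck_on k (\<lambda>x. \<Sum>b\<in>Basis. frechet_derivative F (at x) b *\<^sub>R b) (ball 0 r)"
    using smooth[of "Suc k"]
    by (intro Ck_on_sum Ck_on_scaleR Ck_on_const open_ball) simp
  moreover have "(\<Sum>b\<in>Basis. frechet_derivative F (at x) b *\<^sub>R b) = gradient F x" if "x \<in> ball 0 r" for x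
    using gradient_euclidean(2)[of F x] smooth[of "Suc 0"] that by simp
  ultimately show ?thesis by (rule Ck_on_cong[OF open_ball, rotated])
qed

lemma has_derivative_F: "x \<in> ball 0 r \<Longrightarrow> (F has_derivative (\<lambda>h. h \<bullet> gradient F x)) (at x)"
  using gradient_euclidean(1)[of F x] smooth[of "Suc 0"] by (simp add: gderiv_def)

text \<open>The formula makes sense for every real \<open>s\<close>, which provides the open
  neighbourhood across the face \<open>s = 0\<close> that \<open>smooth_on\<close> asks for.\<close>

lemma smooth_Z: "Ck_on k (Z_r F \<theta>) (UNIV \<times> ball 0 r \<times> UNIV)" (is "Ck_on k _ ?U")
proof -
  have U: "open ?U" by (intro open_Times open_UNIV open_ball)
  have x: "Ck_on k (\<lambda>z::real \<times> 'a \<times> real. fst (snd z)) ?U" for k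
    by (intro Ck_on_bounded_linear bounded_linear_intros)
  have s: "Ck_on k (\<lambda>z::real \<times> 'a \<times> real. fst z) ?U" for k
    by (intro Ck_on_bounded_linear bounded_linear_intros)
  have t: "Ck_on k (\<lambda>z::real \<times> 'a \<times> real. snd (snd z)) ?U" for k
    by (intro Ck_on_bounded_linear bounded_linear_intros)
  have p: "Ck_on k (\<lambda>z::real \<times> 'a \<times> real. gradient F (fst (snd z))) ?U" for k
    by (rule Ck_on_compose[OF U smooth_gradient x]) auto
  have f: "Ck_on k (\<lambda>z::real \<times> 'a \<times> real. F (fst (snd z))) ?U" for k
    by (rule Ck_on_compose[OF U smooth x]) auto
  have q: "1 + gradient F x \<bullet> gradient F x \<noteq> 0" for x
    using norm_gradient_pos[of x] by (simp add: power2_norm_eq_inner)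
  have "Ck_on k (\<lambda>z. (F (fst (snd z)) + 2 * fst z * \<xi>1_r F \<theta> (fst (snd z)),
      fst (snd z) + (2 * fst z) *\<^sub>R \<xi>bar_r F \<theta> (fst (snd z)), snd (snd z) + 2 * fst z)) ?U"
    unfolding \<xi>1_r_def \<xi>bar_r_def power2_norm_eq_inner
    by (intro Ck_on_Pair Ck_on_add Ck_on_diff Ck_on_mult Ck_on_scaleR Ck_on_divide Ck_on_inner
        Ck_on_const U x s t p f) (rule q)+
  then show ?thesis
    by (simp add: Z_r_def case_prod_unfold)
qed

section \<open>Support inequalities and limits of reflected rays\<close>

lemma graph_below_tangent:
  assumes "x \<in> ball 0 r" "y \<in> ball 0 r"
  shows "(graph y - graph x) \<bullet> normal x \<le> 0"
  unfolding inner_normal graph_def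
  using concave[OF assms] norm_gradient_pos[of x]
  by (simp add: divide_le_0_iff inner_commute)

text \<open>\<open>Y\<close> may lie over the boundary of the ball, outside the reach of
  \<open>strict\<close>. The midpoint of \<open>x\<close> and the limiting base point is inside the
  open ball; concavity squeezes its graph point onto the tangent plane at \<open>x\<close>, and
  \<open>strict\<close> makes the midpoint equal to \<open>x\<close>.\<close>

lemma graph_limit_touching_tangent:
  assumes x: "x \<in> ball 0 r" and xs: "\<And>n. xs n \<in> ball 0 r"
    and lim: "(\<lambda>n. graph (xs n)) \<longlonglongrightarrow> Y" and touch: "(Y - graph x) \<bullet> normal x = 0"
  shows "Y = graph x"
proof -
  obtain f y where Y: "Y = (f, y)" by fastforce
  have lims: "(\<lambda>n. F (xs n)) \<longlonglongrightarrow> f" "xs \<longlonglongrightarrow> y"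
    using tendsto_fst[OF lim] tendsto_snd[OF lim] by (simp_all add: Y graph_def)
  have f: "f - F x = gradient F x \<bullet> (y - x)"
    using touch norm_gradient_pos[of x] unfolding inner_normal Y graph_def
    by (simp add: inner_commute)
  have "norm y \<le> r"
    using lims(2) xs by (intro LIMSEQ_le_const2[OF tendsto_norm]) (auto intro: less_imp_le)
  define m where "m v = (1/2) *\<^sub>R (x + v)" for v
  have m_ball: "m v \<in> ball 0 r" if "norm v \<le> r" for v
    using that x norm_triangle_ineq[of x v] by (simp add: m_def)
  \<comment> \<open>Midpoint concavity: the linear terms of the two support inequalities at the
    midpoint cancel.\<close>
  have "F x + F (xs n) \<le> 2 * F (m (xs n))" for n
  proof -
    have mb: "m (xs n) \<in> ball 0 r" using xs[of n] by (intro m_ball) simp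
    have "gradient F (m (xs n)) \<bullet> (x - m (xs n)) + gradient F (m (xs n)) \<bullet> (xs n - m (xs n)) = 0"
      unfolding inner_add_right[symmetric] by (simp add: m_def algebra_simps scaleR_2[symmetric])
    then show ?thesis
      using concave[OF mb x] concave[OF mb xs[of n]] by linarith
  qed
  moreover have "(\<lambda>n. F (m (xs n))) \<longlonglongrightarrow> F (m y)"
  proof -
    have "isCont F (m y)"
      using has_derivative_continuous[OF has_derivative_F[OF m_ball[OF \<open>norm y \<le> r\<close>]]] .
    moreover have "(\<lambda>n. m (xs n)) \<longlonglongrightarrow> m y"
      unfolding m_def by (intro tendsto_intros lims)
    ultimately show ?thesis by (rule isCont_tendsto_compose)
  qed
  ultimately have "F x + f \<le> 2 * F (m y)"
    by (intro LIMSEQ_le[OF tendsto_add[OF tendsto_const lims(1)] tendsto_mult[OF tendsto_const]]) auto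
  moreover have "gradient F x \<bullet> (m y - x) = (1/2) * (gradient F x \<bullet> (y - x))"
    by (simp add: m_def inner_simps)
  ultimately have "F (m y) - F x = gradient F x \<bullet> (m y - x)"
    using concave[OF x m_ball[OF \<open>norm y \<le> r\<close>]] f by linarith
  then have "x = m y"
    using strict[OF x m_ball[OF \<open>norm y \<le> r\<close>]] by blast
  then have "2 *\<^sub>R x = 2 *\<^sub>R m y" by simp
  then have "y = x"
    by (simp add: m_def scaleR_2)
  then show ?thesis using f by (simp add: Y graph_def)
qed

lemma continuous_normal: "continuous_on (ball 0 r) normal"
proof -
  have "continuous_on (ball 0 r) (gradient F)" using smooth_gradient[of 0] by simp
  then show ?thesis
    unfolding normal_def using norm_gradient_pos
    by (intro continuous_intros) (auto simp: less_imp_neq[symmetric] add_nonneg_eq_0_iff)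
qed

text \<open>Both properties of the inverse are contained here: a constant sequence gives
  injectivity, a sequence of preimages gives continuity. Compactness of times and unit normals
  replaces control of \<open>F\<close> and its gradient near the edge of the ball.\<close>

lemma Z_r_limit:
  assumes u: "u \<in> \<omega>_glancing F r \<theta> s0" and \<sigma>: "\<And>n. \<sigma> n \<in> \<omega>_glancing F r \<theta> s0"
    and lim: "(\<lambda>n. Z_r F \<theta> (\<sigma> n)) \<longlonglongrightarrow> Z_r F \<theta> u"
  shows "\<sigma> \<longlonglongrightarrow> u"
proof (rule LIMSEQ_subseqI)
  fix \<rho> :: "nat \<Rightarrow> nat" assume \<rho>: "strict_mono \<rho>"
  obtain s x t where ueq: "u = (s, x, t)" by (cases u)
  define S X T where "S n = fst (\<sigma> (\<rho> n))" and "X n = fst (snd (\<sigma> (\<rho> n)))"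
    and "T n = snd (snd (\<sigma> (\<rho> n)))" for n
  have \<sigma>_eq: "\<sigma> (\<rho> n) = (S n, X n, T n)" for n by (simp add: S_def X_def T_def)
  have x: "x \<in> ball 0 r" "0 \<le> s" "0 \<le> \<theta> \<bullet> gradient F x"
    using u by (auto simp: ueq \<omega>_glancing_def)
  have X: "X n \<in> ball 0 r" "0 \<le> S n" "S n \<le> s0" "0 \<le> \<theta> \<bullet> gradient F (X n)" for n
    using \<sigma>[of "\<rho> n"] by (auto simp: \<sigma>_eq \<omega>_glancing_def)
  have glancing: "(0, \<theta>) \<bullet> normal z \<le> 0" if "0 \<le> \<theta> \<bullet> gradient F z" for z
    using that norm_gradient_pos[of z] by (simp add: inner_normal divide_le_0_iff)
  define W where "W = graph x + (2 * s) *\<^sub>R reflect (normal x)"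
  have "(\<lambda>n. Z_r F \<theta> (\<sigma> (\<rho> n))) \<longlonglongrightarrow> Z_r F \<theta> u"
    using LIMSEQ_subseq_LIMSEQ[OF lim \<rho>] by (simp add: o_def)
  then have Zlim: "(\<lambda>n. (fst (graph (X n) + (2 * S n) *\<^sub>R reflect (normal (X n))),
      snd (graph (X n) + (2 * S n) *\<^sub>R reflect (normal (X n))), T n + 2 * S n)) \<longlonglongrightarrow> (fst W, snd W, t + 2 * s)"
    by (simp only: \<sigma>_eq ueq Z_r_eq W_def)
  have Wlim: "(\<lambda>n. graph (X n) + (2 * S n) *\<^sub>R reflect (normal (X n))) \<longlonglongrightarrow> W"
    using tendsto_Pair[OF tendsto_fst[OF Zlim] tendsto_fst[OF tendsto_snd[OF Zlim]]]
    by (simp only: fst_conv snd_conv prod.collapse)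
  have Tlim: "(\<lambda>n. T n + 2 * S n) \<longlonglongrightarrow> t + 2 * s"
    using tendsto_snd[OF tendsto_snd[OF Zlim]] by simp
  \<comment> \<open>The interval is closed at \<open>s0\<close> to be compact; the limit time is
    identified with \<open>s\<close> below. The third coordinate is recovered last, from the limit
    of \<open>T n + 2 * S n\<close>.\<close>
  have "compact ({0..s0} \<times> sphere (0::real \<times> 'a) 1)"
    by (intro compact_Times compact_Icc compact_sphere)
  moreover have "\<forall>n. (S n, normal (X n)) \<in> {0..s0} \<times> sphere 0 1"
    using X by (simp add: norm_normal)
  ultimately obtain l \<tau> where l: "l \<in> {0..s0} \<times> sphere (0::real \<times> 'a) 1" and \<tau>: "strict_mono \<tau>"
    and llim: "((\<lambda>n. (S n, normal (X n))) \<circ> \<tau>) \<longlonglongrightarrow> l"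
    unfolding compact_def by meson
  obtain s' \<nu> where leq: "l = (s', \<nu>)" by (cases l)
  have s': "0 \<le> s'" "norm \<nu> = 1" using l by (auto simp: leq)
  have Slim: "(\<lambda>n. S (\<tau> n)) \<longlonglongrightarrow> s'" and nlim: "(\<lambda>n. normal (X (\<tau> n))) \<longlonglongrightarrow> \<nu>"
    using tendsto_fst[OF llim] tendsto_snd[OF llim] by (simp_all add: leq o_def)
  \<comment> \<open>Tracing the limit ray back from the endpoint \<open>W\<close> locates the limit
    of the graph points before anything is known about convergence inside the ball.\<close>
  define Y where "Y = W - (2 * s') *\<^sub>R reflect \<nu>"
  have rlim: "(\<lambda>n. reflect (normal (X (\<tau> n)))) \<longlonglongrightarrow> reflect \<nu>"
    unfolding reflect_def by (intro tendsto_intros nlim)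
  have "(\<lambda>n. (graph (X (\<tau> n)) + (2 * S (\<tau> n)) *\<^sub>R reflect (normal (X (\<tau> n))))
      - (2 * S (\<tau> n)) *\<^sub>R reflect (normal (X (\<tau> n)))) \<longlonglongrightarrow> Y"
    unfolding Y_def using LIMSEQ_subseq_LIMSEQ[OF Wlim \<tau>]
    by (intro tendsto_intros rlim Slim) (simp add: o_def)
  then have Ylim: "(\<lambda>n. graph (X (\<tau> n))) \<longlonglongrightarrow> Y" by simp
  have "(Y - graph x) \<bullet> normal x = 0"
  proof (rule reflected_rays_meet[where e = "(0, \<theta>)" and a = "2 * s" and b = "2 * s'" and \<nu> = \<nu>])
    show "norm (normal x) = 1" "norm \<nu> = 1" "0 \<le> 2 * s" "0 \<le> 2 * s'"
      using norm_normal s' x by simp_all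
    show "(0, \<theta>) \<bullet> normal x \<le> 0" using glancing x by blast
    show "(0, \<theta>) \<bullet> \<nu> \<le> 0"
      using X glancing by (intro LIMSEQ_le_const2[OF tendsto_inner[OF tendsto_const nlim]]) blast
    show "graph x + (2 * s) *\<^sub>R ((0, \<theta>) - (2 * ((0, \<theta>) \<bullet> normal x)) *\<^sub>R normal x) =
        Y + (2 * s') *\<^sub>R ((0, \<theta>) - (2 * ((0, \<theta>) \<bullet> \<nu>)) *\<^sub>R \<nu>)"
      unfolding reflect_def[symmetric] Y_def W_def by simp
    show "(Y - graph x) \<bullet> normal x \<le> 0"
      using X x graph_below_tangent
      by (intro LIMSEQ_le_const2[OF tendsto_inner[OF tendsto_diff[OF Ylim tendsto_const] tendsto_const]]) blast
    show "(graph x - Y) \<bullet> \<nu> \<le> 0"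
      using X x graph_below_tangent
      by (intro LIMSEQ_le_const2[OF tendsto_inner[OF tendsto_diff[OF tendsto_const Ylim] nlim]]) blast
  qed
  then have Y: "Y = graph x"
    using graph_limit_touching_tangent[OF x(1) _ Ylim] X by blast
  then have Xlim: "(\<lambda>n. X (\<tau> n)) \<longlonglongrightarrow> x"
    using tendsto_snd[OF Ylim] by (simp add: graph_def)
  have "isCont normal x"
    using continuous_normal x(1) continuous_on_eq_continuous_at[OF open_ball] by blast
  \<comment> \<open>The base points now converge inside the open ball, so the limit normal is the
    true normal at \<open>x\<close>. The two rays share start, end and a unit direction, hence also
    the travel time.\<close>
  then have "\<nu> = normal x"
    using LIMSEQ_unique[OF nlim isCont_tendsto_compose[OF _ Xlim]] by blast
  then have "(2 * s - 2 * s') *\<^sub>R reflect (normal x) = 0"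
    using Y unfolding Y_def W_def by (simp add: algebra_simps)
  then have "s' = s"
    using norm_reflect[OF norm_normal, of x] by auto
  then have "(\<lambda>n. T (\<tau> n)) \<longlonglongrightarrow> t"
    using tendsto_diff[OF LIMSEQ_subseq_LIMSEQ[OF Tlim \<tau>] tendsto_mult[OF tendsto_const[of 2] Slim]]
    by (simp add: o_def)
  then have "(\<lambda>n. (S (\<tau> n), X (\<tau> n), T (\<tau> n))) \<longlonglongrightarrow> u"
    unfolding ueq using Slim Xlim \<open>s' = s\<close> by (intro tendsto_Pair) auto
  then show "\<exists>\<tau>. strict_mono \<tau> \<and> (\<lambda>n. \<sigma> (\<rho> (\<tau> n))) \<longlonglongrightarrow> u"
    using \<tau> by (auto simp: \<sigma>_eq)
qed


section \<open>The derivative of the flow map on the illuminated part\<close>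

text \<open>Adding the support inequalities at \<open>x\<close> and at x + t h shows that for small
  t > 0 the gradient at x + t h, paired with \<open>h\<close>, does not exceed its value at
  \<open>x\<close>; a positive \<open>M h \<bullet> h\<close> would make it larger.\<close>

lemma gradient_derivative_nonpos:
  assumes x: "x \<in> ball 0 r" and M: "(gradient F has_derivative M) (at x)"
  shows "M h \<bullet> h \<le> 0"
proof (rule ccontr)
  assume "\<not> M h \<bullet> h \<le> 0"
  interpret M: bounded_linear M using M by (rule has_derivative_bounded_linear)
  have "((\<lambda>t. x + t *\<^sub>R h) has_derivative (\<lambda>t. t *\<^sub>R h)) (at 0)"
    by (auto intro!: derivative_eq_intros)
  moreover have "(gradient F has_derivative M) (at (x + 0 *\<^sub>R h))" using M by simp
  ultimately have "((\<lambda>t. gradient F (x + t *\<^sub>R h)) has_derivative (\<lambda>t. M (t *\<^sub>R h))) (at 0)"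
    by (rule has_derivative_compose)
  then have "((\<lambda>t. gradient F (x + t *\<^sub>R h) \<bullet> h) has_derivative (\<lambda>t. M (t *\<^sub>R h) \<bullet> h)) (at 0)"
    by (rule has_derivative_inner_left)
  then have "((\<lambda>t. gradient F (x + t *\<^sub>R h) \<bullet> h) has_real_derivative (M h \<bullet> h)) (at 0)"
    unfolding has_field_derivative_def
    by (rule has_derivative_eq_rhs) (simp add: fun_eq_iff M.scaleR)
  from DERIV_pos_inc_right[OF this] \<open>\<not> M h \<bullet> h \<le> 0\<close>
  obtain d where d: "d > 0" "\<And>t. 0 < t \<Longrightarrow> t < d \<Longrightarrow> gradient F x \<bullet> h < gradient F (x + t *\<^sub>R h) \<bullet> h"
    by auto
  have "((\<lambda>t. x + t *\<^sub>R h) \<longlongrightarrow> x + 0 *\<^sub>R h) (at_right 0)"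
    by (intro tendsto_intros)
  then have "\<forall>\<^sub>F t in at_right 0. x + t *\<^sub>R h \<in> ball 0 r"
    using x by (intro topological_tendstoD[OF _ open_ball]) simp_all
  moreover have "\<forall>\<^sub>F t in at_right 0. t \<in> {0<..<d}"
    using d(1) by (rule eventually_at_right_real)
  ultimately have "\<forall>\<^sub>F t in at_right (0::real). False"
  proof eventually_elim
    case (elim t)
    let ?y = "x + t *\<^sub>R h"
    have "F ?y - F x \<le> t * (gradient F x \<bullet> h)" "F x - F ?y \<le> - (t * (gradient F ?y \<bullet> h))"
      using concave[OF x elim(1)] concave[OF elim(1) x] by simp_all
    then have "t * (gradient F ?y \<bullet> h) \<le> t * (gradient F x \<bullet> h)" by linarith
    then show False using d(2)[of t] elim(2) by simp
  qed
  then show False by simp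
qed

lemma inj_derivative_Z:
  assumes x: "x \<in> ball 0 r" and s: "0 \<le> s" and pos: "0 < \<theta> \<bullet> gradient F x"
  shows "inj (frechet_derivative (Z_r F \<theta>) (at (s, x, t)))"
proof -
  define p where "p = gradient F x"
  define c where "c = \<xi>1_r F \<theta> x"
  define q where "q = 1 + p \<bullet> p"
  have "q > 0" unfolding q_def by (simp add: add_pos_nonneg)
  have cdef: "c = 2 * (\<theta> \<bullet> p) / q" and c: "c * q = 2 * (\<theta> \<bullet> p)"
    using \<open>q > 0\<close> by (simp_all add: c_def \<xi>1_r_def p_def q_def power2_norm_eq_inner)
  have "c \<ge> 0" unfolding cdef using pos \<open>q > 0\<close> by (simp add: p_def)
  have \<theta>\<theta>: "\<theta> \<bullet> \<theta> = 1" using norm_\<theta> by (simp add: dot_square_norm)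
  obtain M where M: "(gradient F has_derivative M) (at x)"
    using smooth_gradient[of "Suc 0"] x unfolding Ck_on.simps differentiable_def by blast
  interpret M: bounded_linear M using M by (rule has_derivative_bounded_linear)
  \<comment> \<open>The quotient rule for \<open>\<xi>1_r\<close>, simplified by
    \<open>c * q = 2 * (\<theta> \<bullet> p)\<close> so that a single factor \<open>q\<close>
    remains in the denominator.\<close>
  define C where "C h = (2 * (\<theta> \<bullet> M h) - 2 * c * (p \<bullet> M h)) / q" for h
  have C: "C h * q = 2 * (\<theta> \<bullet> M h) - 2 * c * (p \<bullet> M h)" for h
    using \<open>q > 0\<close> by (simp add: C_def)
  have D1: "(\<xi>1_r F \<theta> has_derivative C) (at x)"
  proof -
    have q0: "1 + gradient F x \<bullet> gradient F x \<noteq> 0"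
      using \<open>q > 0\<close> by (simp add: q_def p_def)
    have "((\<lambda>x. 2 * (\<theta> \<bullet> gradient F x)) has_derivative (\<lambda>h. 2 * (\<theta> \<bullet> M h))) (at x)"
      by (intro derivative_intros M)
    moreover have "((\<lambda>x. 1 + gradient F x \<bullet> gradient F x) has_derivative (\<lambda>h. 2 * (p \<bullet> M h))) (at x)"
      by (auto intro!: derivative_eq_intros M simp: p_def inner_commute)
    ultimately have "(\<xi>1_r F \<theta> has_derivative
        (\<lambda>h. (2 * (\<theta> \<bullet> M h) * q - 2 * (\<theta> \<bullet> p) * (2 * (p \<bullet> M h))) / (q * q))) (at x)"
      unfolding \<xi>1_r_def power2_norm_eq_inner q_def p_def
      by (rule has_derivative_divide') (rule q0)
    moreover have "(2 * (\<theta> \<bullet> M h) * q - 2 * (\<theta> \<bullet> p) * (2 * (p \<bullet> M h))) / (q * q) = C h" for h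
      using \<open>q > 0\<close> unfolding C_def cdef by (simp add: field_simps)
    ultimately show ?thesis by simp
  qed
  have \<xi>bar: "\<xi>bar_r F \<theta> = (\<lambda>x. \<theta> - \<xi>1_r F \<theta> x *\<^sub>R gradient F x)"
    by (simp add: fun_eq_iff \<xi>bar_r_def \<xi>1_r_def)
  have D2: "(\<xi>bar_r F \<theta> has_derivative (\<lambda>h. - (c *\<^sub>R M h + C h *\<^sub>R p))) (at x)"
    unfolding \<xi>bar by (auto intro!: derivative_eq_intros D1 M simp: c_def p_def)
  define D where "D v = (fst (snd v) \<bullet> p + (2 * s * C (fst (snd v)) + 2 * fst v * c),
      fst (snd v) + ((2 * s) *\<^sub>R - (c *\<^sub>R M (fst (snd v)) + C (fst (snd v)) *\<^sub>R p)
        + (2 * fst v) *\<^sub>R (\<theta> - c *\<^sub>R p)),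
      snd (snd v) + 2 * fst v)" for v :: "real \<times> 'a \<times> real"
  have DZ: "(Z_r F \<theta> has_derivative D) (at (s, x, t))"
  proof -
    have px: "((\<lambda>z. fst (snd z)) has_derivative (\<lambda>v. fst (snd v))) (at (s, x, t))"
      by (intro derivative_intros)
    have comp: "((\<lambda>z. f (fst (snd z))) has_derivative (\<lambda>v. f' (fst (snd v)))) (at (s, x, t))"
      if "(f has_derivative f') (at x)" for f :: "'a \<Rightarrow> 'b::real_normed_vector" and f'
      using has_derivative_compose[OF px, of f f'] that by simp
    have "\<theta> - c *\<^sub>R p = \<xi>bar_r F \<theta> x" by (simp add: \<xi>bar c_def p_def)
    then show ?thesis
      unfolding Z_r_def case_prod_unfold D_def
      by (auto intro!: derivative_eq_intros comp[OF has_derivative_F[OF x]] comp[OF D1] comp[OF D2]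
          simp: c_def p_def fun_eq_iff)
  qed
  have "v = 0" if "D v = 0" for v
  proof -
    obtain \<sigma> h \<tau> where v: "v = (\<sigma>, h, \<tau>)" by (cases v)
    have e1: "2 * \<sigma> * c + 2 * s * C h = - (p \<bullet> h)"
      and e2: "h + ((2 * s) *\<^sub>R - (c *\<^sub>R M h + C h *\<^sub>R p) + (2 * \<sigma>) *\<^sub>R (\<theta> - c *\<^sub>R p)) = 0"
      and e3: "\<tau> + 2 * \<sigma> = 0"
      using that by (simp_all add: D_def v zero_prod_def inner_commute)
    \<comment> \<open>The reflected direction with components \<open>c\<close> and
      \<open>\<theta> - c *\<^sub>R p\<close> has unit length for all base points, so it is
      orthogonal to its own derivative.\<close>
    have orth: "c * C h = (\<theta> - c *\<^sub>R p) \<bullet> (c *\<^sub>R M h + C h *\<^sub>R p)"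
    proof -
      have "(\<theta> - c *\<^sub>R p) \<bullet> (c *\<^sub>R M h + C h *\<^sub>R p) - c * C h =
          c * (\<theta> \<bullet> M h - c * (p \<bullet> M h)) + C h * (\<theta> \<bullet> p) - c * C h * q"
        by (simp add: q_def inner_simps algebra_simps)
      also have "\<dots> = c * (C h * q) / 2 + C h * (c * q) / 2 - c * C h * q"
        unfolding C c by (simp add: field_simps)
      finally show ?thesis by simp
    qed
    have unit: "c * c + (\<theta> - c *\<^sub>R p) \<bullet> (\<theta> - c *\<^sub>R p) = 1"
    proof -
      have "c * c + (\<theta> - c *\<^sub>R p) \<bullet> (\<theta> - c *\<^sub>R p) = 1 + c * (c * q) - 2 * c * (\<theta> \<bullet> p)"
        by (simp add: q_def inner_simps inner_commute[of p \<theta>] \<theta>\<theta> algebra_simps)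
      then show ?thesis unfolding c by simp
    qed
    txt \<open>Pairing with the ray direction: reflected rays are orthogonal to the wave fronts.\<close>
    have \<sigma>: "2 * \<sigma> = - (\<theta> \<bullet> h)"
    proof -
      have "0 = (\<theta> - c *\<^sub>R p) \<bullet> (h + ((2 * s) *\<^sub>R - (c *\<^sub>R M h + C h *\<^sub>R p) + (2 * \<sigma>) *\<^sub>R (\<theta> - c *\<^sub>R p)))"
        unfolding e2 by simp
      also have "\<dots> = (\<theta> - c *\<^sub>R p) \<bullet> h - 2 * s * ((\<theta> - c *\<^sub>R p) \<bullet> (c *\<^sub>R M h + C h *\<^sub>R p))
          + 2 * \<sigma> * ((\<theta> - c *\<^sub>R p) \<bullet> (\<theta> - c *\<^sub>R p))"
        by (simp only: inner_add_right inner_scaleR_right inner_minus_right)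
      also have "\<dots> = \<theta> \<bullet> h - c * (p \<bullet> h) - 2 * s * (c * C h) + 2 * \<sigma> * (1 - c * c)"
        unfolding orth[symmetric] using unit by (simp add: inner_diff_left)
      also have "\<dots> = \<theta> \<bullet> h + 2 * \<sigma> - c * (p \<bullet> h + (2 * \<sigma> * c + 2 * s * C h))"
        by (simp add: algebra_simps)
      finally show ?thesis unfolding e1 by simp
    qed
    \<comment> \<open>Pairing the same equation with \<open>h\<close>: \<open>e1\<close> and the
      formula for \<open>2 * \<sigma>\<close> eliminate \<open>C h\<close> and \<sigma>, leaving
      second derivatives of \<open>F\<close> only in \<open>M h \<bullet> h\<close>.\<close>
    have "0 = h \<bullet> (h + ((2 * s) *\<^sub>R - (c *\<^sub>R M h + C h *\<^sub>R p) + (2 * \<sigma>) *\<^sub>R (\<theta> - c *\<^sub>R p)))"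
      unfolding e2 by simp
    also have "\<dots> = h \<bullet> h + 2 * \<sigma> * (\<theta> \<bullet> h) - (2 * \<sigma> * c + 2 * s * C h) * (p \<bullet> h) - 2 * s * c * (M h \<bullet> h)"
      by (simp add: inner_simps inner_commute[of h \<theta>] inner_commute[of h p] inner_commute[of h "M h"] algebra_simps)
    finally have "h \<bullet> h - (\<theta> \<bullet> h)\<^sup>2 + (p \<bullet> h)\<^sup>2 = 2 * s * c * (M h \<bullet> h)"
      unfolding e1 unfolding \<sigma> by (simp add: power2_eq_square)
    also have "\<dots> \<le> 0"
      using gradient_derivative_nonpos[OF x M, of h] s \<open>c \<ge> 0\<close> by (simp add: mult_nonneg_nonpos)
    finally have sum: "h \<bullet> h - (\<theta> \<bullet> h)\<^sup>2 + (p \<bullet> h)\<^sup>2 \<le> 0" .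
    \<comment> \<open>The first two terms of \<open>sum\<close> are the squared length of the part
      of \<open>h\<close> orthogonal to \<theta>, so \<open>sum\<close> bounds a sum of two squares
      by zero.\<close>
    have sq: "(h - (\<theta> \<bullet> h) *\<^sub>R \<theta>) \<bullet> (h - (\<theta> \<bullet> h) *\<^sub>R \<theta>) = h \<bullet> h - (\<theta> \<bullet> h)\<^sup>2"
      by (simp add: inner_simps inner_commute[of h \<theta>] \<theta>\<theta> power2_eq_square)
    have ge: "0 \<le> h \<bullet> h - (\<theta> \<bullet> h)\<^sup>2"
      unfolding sq[symmetric] by (rule inner_ge_zero)
    have "(p \<bullet> h)\<^sup>2 = 0" "(h - (\<theta> \<bullet> h) *\<^sub>R \<theta>) \<bullet> (h - (\<theta> \<bullet> h) *\<^sub>R \<theta>) = 0"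
      using sum ge zero_le_power2[of "p \<bullet> h"] unfolding sq by linarith+
    then have ph: "p \<bullet> h = 0" and h: "h = (\<theta> \<bullet> h) *\<^sub>R \<theta>" by simp_all
    \<comment> \<open>Now \<open>h\<close> is a multiple of \<theta> and orthogonal to
      \<open>p\<close>. The strict inequality in \<open>pos\<close> enters here and excludes a
      nonzero multiple.\<close>
    have "(\<theta> \<bullet> h) * (p \<bullet> \<theta>) = 0"
      using ph h by (metis inner_scaleR_right)
    then have "\<theta> \<bullet> h = 0" using pos by (simp add: p_def inner_commute)
    moreover from this have "h = 0" using h by (metis scale_zero_left)
    ultimately have "h = 0" "\<sigma> = 0" "\<tau> = 0" using \<sigma> e3 by simp_all
    then show ?thesis by (simp add: v zero_prod_def)
  qed
  then have "inj D"
    using linear_injective_0[OF has_derivative_linear[OF DZ]] by blast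
  then show ?thesis using frechet_derivative_at[OF DZ] by simp
qed

section \<open>The global inverse: injectivity, continuity and smoothness\<close>

lemma inverse_Z:
  fixes s0 :: real
  defines "Z \<equiv> Z_r F \<theta>" and "\<Omega> \<equiv> \<omega>_glancing F r \<theta> s0"
  shows "inj_on Z \<Omega>" and "continuous_on (Z ` \<Omega>) (inv_into \<Omega> Z)"
proof -
  show inj: "inj_on Z \<Omega>"
  proof (rule inj_onI)
    fix u v assume "u \<in> \<Omega>" "v \<in> \<Omega>" "Z u = Z v"
    then have "(\<lambda>n. Z ((\<lambda>_::nat. v) n)) \<longlonglongrightarrow> Z u" by simp
    then have "(\<lambda>_::nat. v) \<longlonglongrightarrow> u"
      using \<open>u \<in> \<Omega>\<close> \<open>v \<in> \<Omega>\<close>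
      unfolding Z_def \<Omega>_def by (rule Z_r_limit[rotated 2])
    then show "u = v" by (simp add: LIMSEQ_const_iff)
  qed
  show "continuous_on (Z ` \<Omega>) (inv_into \<Omega> Z)"
  proof (rule continuous_on_sequentiallyI)
    fix y b assume y: "\<forall>n. y n \<in> Z ` \<Omega>" and b: "b \<in> Z ` \<Omega>" and "y \<longlonglongrightarrow> b"
    then have "(\<lambda>n. Z (inv_into \<Omega> Z (y n))) \<longlonglongrightarrow> Z (inv_into \<Omega> Z b)"
      by (simp add: f_inv_into_f)
    moreover have "inv_into \<Omega> Z b \<in> \<Omega>" "inv_into \<Omega> Z (y n) \<in> \<Omega>" for n
      using y b by (simp_all add: inv_into_into)
    ultimately show "(\<lambda>n. inv_into \<Omega> Z (y n)) \<longlonglongrightarrow> inv_into \<Omega> Z b"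
      unfolding Z_def \<Omega>_def by (rule Z_r_limit[rotated 2])
  qed
qed

lemma continuous_Z: "continuous_on (UNIV \<times> ball 0 r \<times> UNIV) (Z_r F \<theta>)"
  using smooth_Z[of 0] by simp

lemma homeomorphism_Z:
  "homeomorphism (\<omega>_glancing F r \<theta> s0) (Z_r F \<theta> ` \<omega>_glancing F r \<theta> s0) (Z_r F \<theta>)
     (inv_into (\<omega>_glancing F r \<theta> s0) (Z_r F \<theta>))"
  unfolding homeomorphism_def
  using inverse_Z[of s0] inv_into_image_cancel[OF inverse_Z(1)[of s0] order_refl]
  by (auto simp: f_inv_into_f \<omega>_glancing_def intro!: continuous_on_subset[OF continuous_Z])

text \<open>The inverse is taken on the larger set \<open>\<omega>_glancing\<close> and is the same
  map as in \<open>homeomorphism_Z\<close>, so the homeomorphism extends the diffeomorphism.\<close>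

lemma smooth_diffeomorphism_Z:
  "smooth_diffeomorphism (\<omega>_ring F r \<theta> s0) (Z_r F \<theta> ` \<omega>_ring F r \<theta> s0) (Z_r F \<theta>)
     (inv_into (\<omega>_glancing F r \<theta> s0) (Z_r F \<theta>))"
proof -
  define Z where "Z = Z_r F \<theta>"
  define \<Omega> R where "\<Omega> = \<omega>_glancing F r \<theta> s0" and "R = \<omega>_ring F r \<theta> s0"
  define G where "G = inv_into \<Omega> Z"
  define E where "E = (UNIV :: real set) \<times> ball (0::'a) r \<times> (UNIV :: real set)"
  have "open E" unfolding E_def by (intro open_Times open_UNIV open_ball)
  have smooth_E: "Ck_on k Z E" for k unfolding Z_def E_def by (rule smooth_Z)
  have "R \<subseteq> \<Omega>" "R \<subseteq> E" by (auto simp: R_def \<Omega>_def E_def \<omega>_ring_def \<omega>_glancing_def)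
  have GZ: "G (Z u) = u" if "u \<in> R" for u
    using that \<open>R \<subseteq> \<Omega>\<close> inverse_Z(1)[of s0] unfolding G_def Z_def \<Omega>_def by (auto intro: inv_into_f_f)
  have "smooth_on R Z"
    unfolding smooth_on_def using \<open>open E\<close> smooth_E \<open>R \<subseteq> E\<close> by blast
  moreover have "smooth_on (Z ` R) G"
    unfolding smooth_on_def
  proof
    fix y assume "y \<in> Z ` R"
    then obtain u where u: "u \<in> R" "y = Z u" by blast
    have inj: "inj (frechet_derivative Z (at u))"
      using u(1) unfolding Z_def R_def \<omega>_ring_def by (auto intro: inj_derivative_Z)
    \<comment> \<open>\<open>u\<close> may lie on the face \<open>s = 0\<close>; the local inverse
      is therefore taken inside the open set \<open>E\<close>, which crosses that face.\<close>
    obtain U g where U: "open U" "u \<in> U" "open (Z ` U)" "\<And>v. v \<in> U \<Longrightarrow> g (Z v) = v"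
        "\<And>k. Ck_on k g (Z ` U)"
      by (rule smooth_local_inverse[OF \<open>open E\<close> smooth_E subsetD[OF \<open>R \<subseteq> E\<close> u(1)] inj])
        (rule that; assumption)
    have "continuous_on (Z ` R) G"
      unfolding G_def Z_def \<Omega>_def
      by (rule continuous_on_subset[OF inverse_Z(2)])
        (use \<open>R \<subseteq> \<Omega>\<close> in \<open>auto simp: \<Omega>_def\<close>)
    \<comment> \<open>The local inverse \<open>g\<close> is tied to points of \<open>U\<close>,
      while \<open>G z\<close> could lie elsewhere. Continuity of \<open>G\<close> confines it to
      \<open>U\<close> for all \<open>z\<close> in \<open>A\<close> that belong to the image of
      \<open>R\<close>.\<close>
    then obtain A where A: "open A" "A \<inter> Z ` R = G -` U \<inter> Z ` R"
      using \<open>open U\<close> unfolding continuous_on_open_invariant by blast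
    have "y \<in> A"
    proof -
      have "G y = u" using GZ[OF u(1)] u(2) by simp
      then have "y \<in> G -` U \<inter> Z ` R" using u U(2) by auto
      then show ?thesis using A(2) by blast
    qed
    have "g z = G z" if "z \<in> Z ` R \<inter> (Z ` U \<inter> A)" for z
    proof -
      have "G z \<in> U" using that A(2) by blast
      moreover have "Z (G z) = z" using that GZ by force
      ultimately show ?thesis using U(4) by metis
    qed
    then show "\<exists>V h. open V \<and> y \<in> V \<and> (\<forall>k. Ck_on k h V) \<and> (\<forall>z\<in>Z ` R \<inter> V. h z = G z)"
      using U A(1) u \<open>y \<in> A\<close>
      by (intro exI[of _ "Z ` U \<inter> A"] exI[of _ g]) (auto intro: Ck_on_subset[OF U(5)])
  qed
  ultimately show ?thesis
    using GZ unfolding smooth_diffeomorphism_def Z_def[symmetric] R_def[symmetric] \<Omega>_def[symmetric] G_def[symmetric]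
    by (auto simp: image_image)
qed

end

theorem proposition8p10:
  fixes \<O> :: "(real \<times> 'a::euclidean_space) set"
    and F :: "'a \<Rightarrow> real"
    and \<theta> :: 'a
    and r s0 :: real
  assumes "open \<O>" and "convex \<O>" and "smooth_boundary \<O>"
    and "P0 \<in> frontier \<O>"
    and "tangent_plane (frontier \<O>) P0 = {x. fst x = 1}"
    and "\<exists>U. open U \<and> P0 \<in> U \<and> (\<forall>x \<in> \<O> \<inter> U. fst x < 1)"
    and "strictly_convex_near_P0 \<O> r F"
    and "\<theta> \<in> sphere 0 1"
    and "s0 > 0"
  shows "(\<exists>g. smooth_diffeomorphism (\<omega>_ring F r \<theta> s0) (Z_r F \<theta> ` \<omega>_ring F r \<theta> s0) (Z_r F \<theta>) g) \<and>
         (\<exists>h. homeomorphism (\<omega>_glancing F r \<theta> s0) (Z_r F \<theta> ` \<omega>_glancing F r \<theta> s0) (Z_r F \<theta>) h)"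
proof -
  interpret concave_reflector F r \<theta>
  proof
    show "Ck_on k F (ball 0 r)" for k
      using assms(7) unfolding strictly_convex_near_P0_def by (blast intro: smooth_on_imp_Ck_on)
  qed (use assms(7,8) in \<open>auto simp: strictly_convex_near_P0_def\<close>)
  show ?thesis
    using smooth_diffeomorphism_Z homeomorphism_Z by blast
qed

end
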